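(* Let $W$ be a finite complex reflection group with standard generating set $S$, let $J\subseteq S$, and let $C_1,\dots,C_r$ be the $J$-conjugacy classes of $W$. Suppose the Hecke algebra $\mathcal H$ of $W$ is a free $R$-module with reduced basis $B=\{\tilde T_{w,B}\mid w\in W\}$. Assume there are elements $w_1,\dots,w_r$ with $w_i\in C_i$ for each $i$ (put $\mathcal M=\{w_1,\dots,w_r\}$) and elements $a_{g,w}\in R$ (for $g\in W\setminus\mathcal M$, $w\in\mathcal M$) such that an element $h=\sum_{g\in W}r_g\tilde T_{g,B}$ ($r_g\in R$) belongs to $Z_{\mathcal H}(\mathcal H_J)$ if and only if $$r_g=\sum_{w\in\mathcal M}a_{g,w}\,r_w\qquad\text{for all } g\in W\setminus\mathcal M .$$ Then there exists a set $\mathcal B=\{b_1,\dots,b_r\}\subseteq Z_{\mathcal H}(\mathcal H_J)$ such that (1) for each $i$, the term $\tilde T_{w_i,B}$ appears in $b_i$ with coefficient $1$ and does not appear with non-zero coefficient in any $b_j$ with $j\ne i$; (2) $\mathcal B$ is an $R$-basis of $Z_{\mathcal H}(\mathcal H_J)$.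
   Context: $W$ is a finite complex reflection group given by a Coxeter-type presentation: a finite generating set $S$ of pseudo-reflections, each $s\in S$ of order $m_s$, with homogeneous (braid) relations together with the order relations $s^{m_s}=1$. Let $\xi_{s,i}$ ($s\in S$, $1\le i<m_s$) be algebraically independent indeterminates over $\mathbb Z$, except that $\xi_{s,i}=\xi_{t,i}$ when $s,t$ are conjugate, and put $\xi_{s,0}=1$; let $R=\mathbb Z[\xi_{s,i}]$. The Hecke algebra $\mathcal H$ of $W$ is the $R$-algebra generated by $\{\tilde T_s\mid s\in S\}$ subject to the homogeneous relations of $W$ (with $\tilde T_s$ in place of $s$) and the order relations $\tilde T_s^{m_s}=\sum_{i=0}^{m_s-1}\xi_{s,i}\tilde T_s^{\,i}$. For a word $\boldsymbol w=s_{i_1}\cdots s_{i_k}$ put $\tilde T_{\boldsymbol w}=\tilde T_{s_{i_1}}\cdots\tilde T_{s_{i_k}}$. A reduced basis $B$ of $\mathcal H$ is an $R$-basis $\{\tilde T_{w,B}\mid w\in W\}$ where, for each $w\in W$, $\tilde T_{w,B}=\tilde T_{\boldsymbol w}$ for some chosen reduced (minimal length) word $\boldsymbol w$ in $S$ representing $w$. For $J\subseteq S$, $W_J=\langle J\rangle$ is the parabolic subgroup and $\mathcal H_J$ is the subalgebra of $\mathcal H$ generated by $\tilde T_s$, $s\in J$. The $J$-conjugacy classes of $W$ are the orbits of $W_J$ acting on $W$ by conjugation. $Z_{\mathcal H}(\mathcal H_J)$ is the centralizer of $\mathcal H_J$ in $\mathcal H$. *)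

theory Defs
  imports
    "HOL-Analysis.Cartesian_Space"
    "HOL-Algebra.Group_Action"
    "HOL-Algebra.Generated_Groups"
    "HOL-Algebra.Multiplicative_Group"
    "HOL-Algebra.Module"
    "HOL-Algebra.QuotRing"
    "HOL-Algebra.Subrings"
    "HOL-Library.Poly_Mapping"
begin

section \<open>Complex reflection groups\<close>

definition GL :: "(complex^'n^'n) monoid" where
  "GL = \<lparr>carrier = {A. invertible A}, monoid.mult = (**), one = mat 1\<rparr>"

text \<open>The fixed space is a complex hyperplane, so dimensions are taken over the complex numbers
  (\<^const>\<open>dim\<close> would be the real dimension). Finiteness of the order is not repeated here:
  the predicate is only applied to elements of finite groups.\<close>

definition pseudo_reflection :: "complex^'n^'n \<Rightarrow> bool" where
  "pseudo_reflection A \<longleftrightarrow> invertible A \<and> vec.dim {v. A *v v = v} = CARD('n) - 1"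

definition complex_reflection_group :: "(complex^'n^'n) monoid \<Rightarrow> bool" where
  "complex_reflection_group W \<longleftrightarrow>
     W = GL\<lparr>carrier := carrier W\<rparr> \<and> subgroup (carrier W) GL \<and> finite (carrier W) \<and>
     generate W {s \<in> carrier W. pseudo_reflection s} = carrier W"


section \<open>Group presentations\<close>

definition word_prod :: "('a, 'b) monoid_scheme \<Rightarrow> 'a list \<Rightarrow> 'a" where
  "word_prod G w = foldr (\<otimes>\<^bsub>G\<^esub>) w \<one>\<^bsub>G\<^esub>"

text \<open>A signed letter \<^term>\<open>(s, True)\<close> stands for \<open>s\<close>, and \<^term>\<open>(s, False)\<close> for its formal inverse.
  The group \<open>\<langle>X | E\<rangle>\<close> consists of the signed words over \<open>X\<close> modulo the congruence generated by
  free cancellation and the relations \<open>p = q\<close> for \<^term>\<open>(p, q) \<in> E\<close>; all relations considered here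
  are between positive words.\<close>

inductive presented_eq ::
  "'a set \<Rightarrow> ('a list \<times> 'a list) set \<Rightarrow> ('a \<times> bool) list \<Rightarrow> ('a \<times> bool) list \<Rightarrow> bool"
  for X E where
  refl: "presented_eq X E u u"
| sym: "presented_eq X E u v \<Longrightarrow> presented_eq X E v u"
| trans: "presented_eq X E u v \<Longrightarrow> presented_eq X E v w \<Longrightarrow> presented_eq X E u w"
| cancel: "s \<in> X \<Longrightarrow> presented_eq X E (u @ [(s, e), (s, \<not> e)] @ v) (u @ v)"
| relation: "(p, q) \<in> E \<Longrightarrow>
    presented_eq X E (u @ map (\<lambda>s. (s, True)) p @ v) (u @ map (\<lambda>s. (s, True)) q @ v)"

definition signed_word_prod :: "('a, 'b) monoid_scheme \<Rightarrow> ('a \<times> bool) list \<Rightarrow> 'a" where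
  "signed_word_prod G w = word_prod G (map (\<lambda>(s, e). if e then s else inv\<^bsub>G\<^esub> s) w)"

definition presents :: "('a, 'b) monoid_scheme \<Rightarrow> 'a set \<Rightarrow> ('a list \<times> 'a list) set \<Rightarrow> bool" where
  "presents G X E \<longleftrightarrow>
     X \<subseteq> carrier G \<and> generate G X = carrier G \<and>
     (\<forall>u v. fst ` set u \<subseteq> X \<and> fst ` set v \<subseteq> X \<longrightarrow>
        (signed_word_prod G u = signed_word_prod G v \<longleftrightarrow> presented_eq X E u v))"

text \<open>\<open>E\<close> is the set of homogeneous relations; the order relations are added here.\<close>

definition coxeter_type_presentation ::
  "(complex^'n^'n) monoid \<Rightarrow> (complex^'n^'n) set \<Rightarrow>
   ((complex^'n^'n) list \<times> (complex^'n^'n) list) set \<Rightarrow> bool" where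
  "coxeter_type_presentation W S E \<longleftrightarrow>
     finite S \<and> (\<forall>s\<in>S. pseudo_reflection s) \<and>
     (\<forall>(u, v)\<in>E. set u \<subseteq> S \<and> set v \<subseteq> S \<and> length u = length v) \<and>
     presents W S (E \<union> {(replicate (group.ord W s) s, []) | s. s \<in> S})"


section \<open>Conjugacy\<close>

definition conj_action :: "('a, 'b) monoid_scheme \<Rightarrow> 'a \<Rightarrow> 'a \<Rightarrow> 'a" where
  "conj_action G g = (\<lambda>x\<in>carrier G. g \<otimes>\<^bsub>G\<^esub> x \<otimes>\<^bsub>G\<^esub> inv\<^bsub>G\<^esub> g)"

definition J_conjugacy_classes :: "('a, 'b) monoid_scheme \<Rightarrow> 'a set \<Rightarrow> 'a set set" where
  "J_conjugacy_classes W J = orbits (subgroup_generated W J) (carrier W) (conj_action W)"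


section \<open>The coefficient ring\<close>

text \<open>Integer polynomials in the variables \<open>V\<close>; a monomial is a finitely supported exponent
  function.\<close>

definition int_poly_ring :: "'v set \<Rightarrow> (('v \<Rightarrow>\<^sub>0 nat) \<Rightarrow>\<^sub>0 int) ring" where
  "int_poly_ring V =
     \<lparr>carrier = {p. \<forall>m \<in> Poly_Mapping.keys p. Poly_Mapping.keys m \<subseteq> V},
      monoid.mult = (*), one = 1, zero = 0, add = (+)\<rparr>"

definition int_poly_var :: "'v \<Rightarrow> (('v \<Rightarrow>\<^sub>0 nat) \<Rightarrow>\<^sub>0 int)" where
  "int_poly_var x = Poly_Mapping.single (Poly_Mapping.single x 1) 1"

text \<open>The indeterminate \<open>\<xi>\<^sub>s\<^sub>,\<^sub>i\<close> is labelled by the conjugacy class of \<open>s\<close> together with \<open>i\<close>,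
  which identifies exactly the parameters of conjugate generators.\<close>

definition hecke_vars :: "('a, 'b) monoid_scheme \<Rightarrow> 'a set \<Rightarrow> ('a set \<times> nat) set" where
  "hecke_vars W S =
     {(orbit W (conj_action W) s, i) | s i. s \<in> S \<and> 1 \<le> i \<and> i < group.ord W s}"

definition hecke_param ::
  "('a, 'b) monoid_scheme \<Rightarrow> 'a \<Rightarrow> nat \<Rightarrow> (('a set \<times> nat) \<Rightarrow>\<^sub>0 nat) \<Rightarrow>\<^sub>0 int" where
  "hecke_param W s i = (if i = 0 then 1 else int_poly_var (orbit W (conj_action W) s, i))"

definition hecke_ring ::
  "('a, 'b) monoid_scheme \<Rightarrow> 'a set \<Rightarrow> ((('a set \<times> nat) \<Rightarrow>\<^sub>0 nat) \<Rightarrow>\<^sub>0 int) ring" where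
  "hecke_ring W S = int_poly_ring (hecke_vars W S)"


section \<open>Algebras and modules\<close>

text \<open>HOL-Algebra's locale \<^locale>\<open>algebra\<close> is restricted to commutative algebras; only the record
  type underlying it is used below.

  The free associative unital \<open>R\<close>-algebra on \<open>X\<close>: finitely supported functions from words over \<open>X\<close>
  to \<open>R\<close>, with multiplication induced by concatenation, i.e. summing over all ways to split a
  word into two factors.\<close>

definition free_algebra ::
  "('r, 'c) ring_scheme \<Rightarrow> 'x set \<Rightarrow> ('r, 'x list \<Rightarrow> 'r) module" where
  "free_algebra R X =
     \<lparr>carrier = {f. (\<forall>w. f w \<in> carrier R) \<and> finite {w. f w \<noteq> \<zero>\<^bsub>R\<^esub>} \<and>
                    (\<forall>w. f w \<noteq> \<zero>\<^bsub>R\<^esub> \<longrightarrow> set w \<subseteq> X)},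
      monoid.mult = (\<lambda>f g w. \<Oplus>\<^bsub>R\<^esub>k\<in>{..length w}. f (take k w) \<otimes>\<^bsub>R\<^esub> g (drop k w)),
      one = (\<lambda>w. if w = [] then \<one>\<^bsub>R\<^esub> else \<zero>\<^bsub>R\<^esub>),
      zero = (\<lambda>w. \<zero>\<^bsub>R\<^esub>),
      add = (\<lambda>f g w. f w \<oplus>\<^bsub>R\<^esub> g w),
      smult = (\<lambda>r f w. r \<otimes>\<^bsub>R\<^esub> f w)\<rparr>"

definition free_gen :: "('r, 'c) ring_scheme \<Rightarrow> 'x \<Rightarrow> 'x list \<Rightarrow> 'r" where
  "free_gen R x = (\<lambda>w. if w = [x] then \<one>\<^bsub>R\<^esub> else \<zero>\<^bsub>R\<^esub>)"

text \<open>The ring \<^term>\<open>A Quot I\<close> with the induced scalar multiplication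
  \<open>r \<odot> (I + x) = I + r \<odot> x\<close>, written as a union over representatives in the same way as
  \<^const>\<open>rcoset_mult\<close>.\<close>

definition quotient_algebra ::
  "('r, 'm, 'c) module_scheme \<Rightarrow> 'm set \<Rightarrow> ('r, 'm set) module" where
  "quotient_algebra A I =
     \<lparr>carrier = carrier (A Quot I), monoid.mult = monoid.mult (A Quot I), one = one (A Quot I),
      zero = zero (A Quot I), add = add (A Quot I),
      smult = (\<lambda>r X. \<Union>x\<in>X. I +>\<^bsub>A\<^esub> (r \<odot>\<^bsub>A\<^esub> x))\<rparr>"

definition generated_subalgebra ::
  "('r, 'c) ring_scheme \<Rightarrow> ('r, 'm, 'd) module_scheme \<Rightarrow> 'm set \<Rightarrow> 'm set" where
  "generated_subalgebra R A X = \<Inter>{B. subring B A \<and> submodule B R A \<and> X \<subseteq> B}"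

definition centralizer :: "('m, 'd) ring_scheme \<Rightarrow> 'm set \<Rightarrow> 'm set" where
  "centralizer A B = {h \<in> carrier A. \<forall>x\<in>B. h \<otimes>\<^bsub>A\<^esub> x = x \<otimes>\<^bsub>A\<^esub> h}"

text \<open>The finite family \<open>(b i)\<close>, \<open>i \<in> I\<close>, is an \<open>R\<close>-basis of the submodule \<open>N\<close> of \<open>M\<close>. Since bases
  are families, \<open>b\<close> is injective on \<open>I\<close> over a nonzero ring.\<close>

definition module_basis ::
  "('r, 'c) ring_scheme \<Rightarrow> ('r, 'm, 'd) module_scheme \<Rightarrow> 'm set \<Rightarrow> 'i set \<Rightarrow> ('i \<Rightarrow> 'm) \<Rightarrow> bool" where
  "module_basis R M N I b \<longleftrightarrow>
     submodule N R M \<and> finite I \<and> b \<in> I \<rightarrow> N \<and>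
     (\<forall>c \<in> I \<rightarrow> carrier R.
        (\<Oplus>\<^bsub>M\<^esub>i\<in>I. c i \<odot>\<^bsub>M\<^esub> b i) = \<zero>\<^bsub>M\<^esub> \<longrightarrow> (\<forall>i\<in>I. c i = \<zero>\<^bsub>R\<^esub>)) \<and>
     (\<forall>x \<in> N. \<exists>c \<in> I \<rightarrow> carrier R. x = (\<Oplus>\<^bsub>M\<^esub>i\<in>I. c i \<odot>\<^bsub>M\<^esub> b i))"

definition basis_coeff ::
  "('r, 'c) ring_scheme \<Rightarrow> ('r, 'm, 'd) module_scheme \<Rightarrow> 'i set \<Rightarrow> ('i \<Rightarrow> 'm) \<Rightarrow> 'm \<Rightarrow> 'i \<Rightarrow> 'r" where
  "basis_coeff R M I b x i =
     (THE r. \<exists>c \<in> I \<rightarrow> carrier R. x = (\<Oplus>\<^bsub>M\<^esub>j\<in>I. c j \<odot>\<^bsub>M\<^esub> b j) \<and> r = c i)"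


section \<open>The Hecke algebra\<close>

definition hecke_relators ::
  "('a, 'b) monoid_scheme \<Rightarrow> 'a set \<Rightarrow> ('a list \<times> 'a list) set \<Rightarrow>
   ('a list \<Rightarrow> (('a set \<times> nat) \<Rightarrow>\<^sub>0 nat) \<Rightarrow>\<^sub>0 int) set" where
  "hecke_relators W S E =
     (let R = hecke_ring W S; F = free_algebra R S; t = free_gen R in
      {word_prod F (map t u) \<ominus>\<^bsub>F\<^esub> word_prod F (map t v) | u v. (u, v) \<in> E} \<union>
      {(t s [^]\<^bsub>F\<^esub> group.ord W s) \<ominus>\<^bsub>F\<^esub>
         (\<Oplus>\<^bsub>F\<^esub>i\<in>{..<group.ord W s}. hecke_param W s i \<odot>\<^bsub>F\<^esub> (t s [^]\<^bsub>F\<^esub> i)) | s. s \<in> S})"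

definition hecke_ideal ::
  "('a, 'b) monoid_scheme \<Rightarrow> 'a set \<Rightarrow> ('a list \<times> 'a list) set \<Rightarrow>
   ('a list \<Rightarrow> (('a set \<times> nat) \<Rightarrow>\<^sub>0 nat) \<Rightarrow>\<^sub>0 int) set" where
  "hecke_ideal W S E = genideal (free_algebra (hecke_ring W S) S) (hecke_relators W S E)"

definition hecke_algebra ::
  "('a, 'b) monoid_scheme \<Rightarrow> 'a set \<Rightarrow> ('a list \<times> 'a list) set \<Rightarrow>
   ((('a set \<times> nat) \<Rightarrow>\<^sub>0 nat) \<Rightarrow>\<^sub>0 int, ('a list \<Rightarrow> (('a set \<times> nat) \<Rightarrow>\<^sub>0 nat) \<Rightarrow>\<^sub>0 int) set) module" where
  "hecke_algebra W S E = quotient_algebra (free_algebra (hecke_ring W S) S) (hecke_ideal W S E)"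

definition hecke_T ::
  "('a, 'b) monoid_scheme \<Rightarrow> 'a set \<Rightarrow> ('a list \<times> 'a list) set \<Rightarrow> 'a \<Rightarrow>
   ('a list \<Rightarrow> (('a set \<times> nat) \<Rightarrow>\<^sub>0 nat) \<Rightarrow>\<^sub>0 int) set" where
  "hecke_T W S E s =
     hecke_ideal W S E +>\<^bsub>free_algebra (hecke_ring W S) S\<^esub> free_gen (hecke_ring W S) s"

definition hecke_T_word ::
  "('a, 'b) monoid_scheme \<Rightarrow> 'a set \<Rightarrow> ('a list \<times> 'a list) set \<Rightarrow> 'a list \<Rightarrow>
   ('a list \<Rightarrow> (('a set \<times> nat) \<Rightarrow>\<^sub>0 nat) \<Rightarrow>\<^sub>0 int) set" where
  "hecke_T_word W S E u = word_prod (hecke_algebra W S E) (map (hecke_T W S E) u)"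

definition hecke_parabolic ::
  "('a, 'b) monoid_scheme \<Rightarrow> 'a set \<Rightarrow> ('a list \<times> 'a list) set \<Rightarrow> 'a set \<Rightarrow>
   ('a list \<Rightarrow> (('a set \<times> nat) \<Rightarrow>\<^sub>0 nat) \<Rightarrow>\<^sub>0 int) set set" where
  "hecke_parabolic W S E J =
     generated_subalgebra (hecke_ring W S) (hecke_algebra W S E) (hecke_T W S E ` J)"

definition reduced_word :: "('a, 'b) monoid_scheme \<Rightarrow> 'a set \<Rightarrow> 'a \<Rightarrow> 'a list \<Rightarrow> bool" where
  "reduced_word W S w u \<longleftrightarrow>
     set u \<subseteq> S \<and> word_prod W u = w \<and>
     (\<forall>v. set v \<subseteq> S \<and> word_prod W v = w \<longrightarrow> length u \<le> length v)"

text \<open>A reduced basis \<open>B\<close> is recorded as the choice \<open>\<rho>\<close> of a reduced word for each group element;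
  its elements are \<^term>\<open>hecke_T_word W S E (\<rho> w)\<close> for \<^term>\<open>w \<in> carrier W\<close>.\<close>

definition reduced_basis ::
  "('a, 'b) monoid_scheme \<Rightarrow> 'a set \<Rightarrow> ('a list \<times> 'a list) set \<Rightarrow> ('a \<Rightarrow> 'a list) \<Rightarrow> bool" where
  "reduced_basis W S E \<rho> \<longleftrightarrow>
     (\<forall>w \<in> carrier W. reduced_word W S w (\<rho> w)) \<and>
     module_basis (hecke_ring W S) (hecke_algebra W S E) (carrier (hecke_algebra W S E))
       (carrier W) (\<lambda>w. hecke_T_word W S E (\<rho> w))"

end

theory Submission
  imports Defs
begin

text \<open>The defining equations of the centralizer in the reduced basis leave the coordinates
  \<open>r\<^sub>w\<close>, \<open>w \<in> \<M>\<close>, free and make all other coordinates linear functions of them. Hence the elements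
  \<open>b\<^sub>i\<close> obtained by setting the free coordinate at \<open>w\<^sub>i\<close> to 1 and the remaining free ones to 0 form a
  basis: \<open>r\<^sub>w\<close> is read off any combination of the \<open>b\<^sub>i\<close> at \<open>w\<close>. The \<open>w\<^sub>i\<close> are distinct because orbits
  are disjoint. That the centralizer is a submodule needs the Hecke algebra to be an
  associative algebra, which it inherits from the free algebra.\<close>

section \<open>Finite sums\<close>

text \<open>Serves to regroup a combination of vectors, each given in coordinates, by basis
  vector.\<close>

lemma (in abelian_monoid) finsum_swap:
  assumes "finite A" "finite B" "\<And>i j. i \<in> A \<Longrightarrow> j \<in> B \<Longrightarrow> f i j \<in> carrier G"
  shows "(\<Oplus>i\<in>A. \<Oplus>j\<in>B. f i j) = (\<Oplus>j\<in>B. \<Oplus>i\<in>A. f i j)"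
  using assms(1,3)
proof (induction A rule: finite_induct)
  case empty
  then show ?case by simp
next
  case (insert x A)
  then have "(\<Oplus>j\<in>B. \<Oplus>i\<in>insert x A. f i j) = (\<Oplus>j\<in>B. f x j \<oplus> (\<Oplus>i\<in>A. f i j))"
    by (intro finsum_cong') (auto intro!: finsum_closed simp: Pi_def)
  also have "\<dots> = (\<Oplus>j\<in>B. f x j) \<oplus> (\<Oplus>j\<in>B. \<Oplus>i\<in>A. f i j)"
    using insert by (intro finsum_addf) (auto intro!: finsum_closed)
  also have "\<dots> = (\<Oplus>i\<in>insert x A. \<Oplus>j\<in>B. f i j)"
    using insert by (simp add: Pi_def finsum_closed)
  finally show ?case by simp
qed

text \<open>This is the reindexing behind associativity of a convolution product: \<open>j\<close>
  and \<open>k\<close> are the two cut points of a word, and \<open>i\<close> is the length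
  \<open>k - j\<close> of the middle piece. In the induction, the new value \<open>k = Suc n\<close>
  adds one term to each inner sum with \<open>j \<le> n\<close>, plus the corner term at
  \<open>j = Suc n\<close>.\<close>

lemma (in abelian_monoid) finsum_triangle:
  fixes n :: nat
  assumes "\<And>j k. j \<le> k \<Longrightarrow> k \<le> n \<Longrightarrow> f j k \<in> carrier G"
  shows "(\<Oplus>k\<in>{..n}. \<Oplus>j\<in>{..k}. f j k) = (\<Oplus>j\<in>{..n}. \<Oplus>i\<in>{..n - j}. f j (i + j))"
  using assms
proof (induction n)
  case 0
  then show ?case by simp
next
  case (Suc n)
  have "(\<Oplus>j\<in>{..Suc n}. \<Oplus>i\<in>{..Suc n - j}. f j (i + j))
      = f (Suc n) (Suc n) \<oplus> (\<Oplus>j\<in>{..n}. \<Oplus>i\<in>{..Suc n - j}. f j (i + j))"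
    using Suc.prems by (subst finsum_Suc) (auto intro!: finsum_closed)
  \<comment> \<open>Here \<open>Suc n - j = Suc (n - j)\<close>, so the top term of each inner sum
    is the one with \<open>i + j = Suc n\<close>.\<close>
  also have "(\<Oplus>j\<in>{..n}. \<Oplus>i\<in>{..Suc n - j}. f j (i + j))
      = (\<Oplus>j\<in>{..n}. f j (Suc n) \<oplus> (\<Oplus>i\<in>{..n - j}. f j (i + j)))"
    using Suc.prems by (intro finsum_cong') (auto simp: Suc_diff_le Pi_def intro!: finsum_closed)
  also have "\<dots> = (\<Oplus>j\<in>{..n}. f j (Suc n)) \<oplus> (\<Oplus>j\<in>{..n}. \<Oplus>i\<in>{..n - j}. f j (i + j))"
    using Suc.prems by (intro finsum_addf) (auto intro!: finsum_closed)
  also have "(\<Oplus>j\<in>{..n}. \<Oplus>i\<in>{..n - j}. f j (i + j)) = (\<Oplus>k\<in>{..n}. \<Oplus>j\<in>{..k}. f j k)"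
    using Suc by simp
  also have "f (Suc n) (Suc n) \<oplus> ((\<Oplus>j\<in>{..n}. f j (Suc n)) \<oplus> (\<Oplus>k\<in>{..n}. \<Oplus>j\<in>{..k}. f j k))
      = (\<Oplus>j\<in>{..Suc n}. f j (Suc n)) \<oplus> (\<Oplus>k\<in>{..n}. \<Oplus>j\<in>{..k}. f j k)"
    using Suc.prems by (subst finsum_Suc) (auto simp: a_assoc Pi_def finsum_closed)
  also have "\<dots> = (\<Oplus>k\<in>{..Suc n}. \<Oplus>j\<in>{..k}. f j k)"
    using Suc.prems by (subst (2) finsum_Suc) (auto intro!: finsum_closed)
  finally show ?case by simp
qed

lemma (in module) finsum_smult_rdistr:
  assumes "finite A" "f \<in> A \<rightarrow> carrier R" "x \<in> carrier M"
  shows "(\<Oplus>i\<in>A. f i) \<odot>\<^bsub>M\<^esub> x = (\<Oplus>\<^bsub>M\<^esub>i\<in>A. f i \<odot>\<^bsub>M\<^esub> x)"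
  using assms by (induction A rule: finite_induct) (auto simp: Pi_def smult_l_distr R.finsum_closed)


section \<open>Bases of parametrized submodules\<close>

context module
begin

text \<open>Justifies the definite description in \<open>basis_coeff\<close>: the difference of two
  coordinate families of one vector gives a vanishing combination, so independence makes them
  agree.\<close>

lemma basis_coeff_eq:
  assumes basis: "module_basis R M N I T" and c: "c \<in> I \<rightarrow> carrier R" and "i \<in> I"
  shows "basis_coeff R M I T (\<Oplus>\<^bsub>M\<^esub>j\<in>I. c j \<odot>\<^bsub>M\<^esub> T j) i = c i"
proof -
  have fin: "finite I" and T: "T \<in> I \<rightarrow> carrier M"
    and indep: "\<And>d. d \<in> I \<rightarrow> carrier R \<Longrightarrow> (\<Oplus>\<^bsub>M\<^esub>j\<in>I. d j \<odot>\<^bsub>M\<^esub> T j) = \<zero>\<^bsub>M\<^esub> \<Longrightarrow> \<forall>j\<in>I. d j = \<zero>"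
    using basis submoduleE(1)[of N] by (auto simp: module_basis_def)
  have eq: "d i = c i"
    if d: "d \<in> I \<rightarrow> carrier R" and sums: "(\<Oplus>\<^bsub>M\<^esub>j\<in>I. c j \<odot>\<^bsub>M\<^esub> T j) = (\<Oplus>\<^bsub>M\<^esub>j\<in>I. d j \<odot>\<^bsub>M\<^esub> T j)" for d
  proof -
    have cl: "(\<Oplus>\<^bsub>M\<^esub>j\<in>I. d j \<odot>\<^bsub>M\<^esub> T j) \<in> carrier M" "(\<Oplus>\<^bsub>M\<^esub>j\<in>I. (\<ominus> c j) \<odot>\<^bsub>M\<^esub> T j) \<in> carrier M"
      using c d T by (auto intro!: M.finsum_closed simp: Pi_def)
    have "(\<Oplus>\<^bsub>M\<^esub>j\<in>I. (d j \<ominus> c j) \<odot>\<^bsub>M\<^esub> T j) = (\<Oplus>\<^bsub>M\<^esub>j\<in>I. d j \<odot>\<^bsub>M\<^esub> T j \<oplus>\<^bsub>M\<^esub> (\<ominus> c j) \<odot>\<^bsub>M\<^esub> T j)"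
      using c d T by (intro M.finsum_cong') (auto simp: Pi_def a_minus_def smult_l_distr)
    also have "\<dots> = (\<Oplus>\<^bsub>M\<^esub>j\<in>I. d j \<odot>\<^bsub>M\<^esub> T j) \<oplus>\<^bsub>M\<^esub> (\<Oplus>\<^bsub>M\<^esub>j\<in>I. (\<ominus> c j) \<odot>\<^bsub>M\<^esub> T j)"
      using c d T by (intro M.finsum_addf) (auto simp: Pi_def)
    also have "\<dots> = (\<Oplus>\<^bsub>M\<^esub>j\<in>I. c j \<odot>\<^bsub>M\<^esub> T j) \<oplus>\<^bsub>M\<^esub> (\<Oplus>\<^bsub>M\<^esub>j\<in>I. (\<ominus> c j) \<odot>\<^bsub>M\<^esub> T j)"
      using sums by simp
    also have "\<dots> = (\<Oplus>\<^bsub>M\<^esub>j\<in>I. c j \<odot>\<^bsub>M\<^esub> T j \<oplus>\<^bsub>M\<^esub> (\<ominus> c j) \<odot>\<^bsub>M\<^esub> T j)"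
      using c T by (intro M.finsum_addf[symmetric]) (auto simp: Pi_def)
    also have "\<dots> = (\<Oplus>\<^bsub>M\<^esub>j\<in>I. \<zero>\<^bsub>M\<^esub>)"
      using c T by (intro M.finsum_cong') (auto simp: Pi_def smult_l_minus M.r_neg)
    finally have "(\<Oplus>\<^bsub>M\<^esub>j\<in>I. (d j \<ominus> c j) \<odot>\<^bsub>M\<^esub> T j) = \<zero>\<^bsub>M\<^esub>"
      by simp
    moreover have "(\<lambda>j. d j \<ominus> c j) \<in> I \<rightarrow> carrier R"
      using c d by auto
    ultimately have "d i \<ominus> c i = \<zero>"
      using indep \<open>i \<in> I\<close> by blast
    moreover have "c i \<in> carrier R" "d i \<in> carrier R"
      using c d \<open>i \<in> I\<close> by auto
    ultimately show ?thesis
      by simp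
  qed
  show ?thesis
    unfolding basis_coeff_def
  proof (rule the_equality)
    show "\<exists>d\<in>I \<rightarrow> carrier R.
        (\<Oplus>\<^bsub>M\<^esub>j\<in>I. c j \<odot>\<^bsub>M\<^esub> T j) = (\<Oplus>\<^bsub>M\<^esub>j\<in>I. d j \<odot>\<^bsub>M\<^esub> T j) \<and> c i = d i"
      using c by blast
  qed (use eq in blast)
qed

lemma basis_of_parametrized_submodule:
  assumes basis: "module_basis R M (carrier M) I T"
    and sub: "submodule N R M"
    and w: "inj_on w K" "w ` K \<subseteq> I"
    and a: "\<And>g v. g \<in> I - w ` K \<Longrightarrow> v \<in> w ` K \<Longrightarrow> a g v \<in> carrier R"
    and param: "\<And>c. c \<in> I \<rightarrow> carrier R \<Longrightarrow>
      (\<Oplus>\<^bsub>M\<^esub>g\<in>I. c g \<odot>\<^bsub>M\<^esub> T g) \<in> N \<longleftrightarrow> (\<forall>g \<in> I - w ` K. c g = (\<Oplus>v\<in>w ` K. a g v \<otimes> c v))"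
  shows "\<exists>b. b ` K \<subseteq> N \<and>
    (\<forall>i\<in>K. basis_coeff R M I T (b i) (w i) = \<one> \<and>
      (\<forall>j\<in>K. j \<noteq> i \<longrightarrow> basis_coeff R M I T (b j) (w i) = \<zero>)) \<and>
    module_basis R M N K b"
proof -
  have fin: "finite I" and T: "T \<in> I \<rightarrow> carrier M"
    and indep: "\<And>d. d \<in> I \<rightarrow> carrier R \<Longrightarrow> (\<Oplus>\<^bsub>M\<^esub>j\<in>I. d j \<odot>\<^bsub>M\<^esub> T j) = \<zero>\<^bsub>M\<^esub> \<Longrightarrow> \<forall>j\<in>I. d j = \<zero>"
    and span: "\<And>x. x \<in> carrier M \<Longrightarrow> \<exists>c \<in> I \<rightarrow> carrier R. x = (\<Oplus>\<^bsub>M\<^esub>j\<in>I. c j \<odot>\<^bsub>M\<^esub> T j)"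
    using basis by (auto simp: module_basis_def)
  have finK: "finite K"
    using fin w finite_imageD finite_subset by blast
  \<comment> \<open>\<open>e i\<close> is the coordinate vector of \<open>b i\<close>: a unit vector
    on the free coordinates and column \<open>w i\<close> of the matrix \<open>a\<close>
    elsewhere.\<close>
  define e where "e i g = (if g \<in> w ` K then (if g = w i then \<one> else \<zero>) else a g (w i))" for i g
  define b where "b i = (\<Oplus>\<^bsub>M\<^esub>g\<in>I. e i g \<odot>\<^bsub>M\<^esub> T g)" for i
  have e: "e i g \<in> carrier R" if "i \<in> K" "g \<in> I" for i g
    using that a[of g "w i"] by (auto simp: e_def)
  \<comment> \<open>Injectivity of \<open>w\<close> turns the test \<open>w j = w k\<close> into
    \<open>j = k\<close>, a Kronecker delta.\<close>
  have pick: "(\<Oplus>k\<in>K. c k \<otimes> (if w j = w k then \<one> else \<zero>)) = c j"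
    if "c \<in> K \<rightarrow> carrier R" "j \<in> K" for c j
  proof -
    have "(\<Oplus>k\<in>K. c k \<otimes> (if w j = w k then \<one> else \<zero>)) = (\<Oplus>k\<in>K. if j = k then c k else \<zero>)"
      using that w(1) by (intro R.finsum_cong') (auto simp: Pi_def dest: inj_onD)
    also have "\<dots> = c j"
      using that finK by (intro R.finsum_singleton) auto
    finally show ?thesis .
  qed
  have coord: "(\<Oplus>k\<in>K. c k \<otimes> e k (w j)) = c j" if "c \<in> K \<rightarrow> carrier R" "j \<in> K" for c j
    using pick[OF that] that(2) by (simp add: e_def)
  have bN: "b i \<in> N" if i: "i \<in> K" for i
  proof -
    \<comment> \<open>The unit vector on the free coordinates collapses the sum to the single entry
      \<open>a g (w i)\<close>, which is how \<open>e i g\<close> was chosen.\<close>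
    have "e i g = (\<Oplus>v\<in>w ` K. a g v \<otimes> e i v)" if g: "g \<in> I - w ` K" for g
    proof -
      have "(\<Oplus>v\<in>w ` K. a g v \<otimes> e i v) = (\<Oplus>k\<in>K. a g (w k) \<otimes> e i (w k))"
        using a g e i w by (intro R.finsum_reindex) auto
      also have "\<dots> = (\<Oplus>k\<in>K. a g (w k) \<otimes> (if w i = w k then \<one> else \<zero>))"
        using a g by (intro R.finsum_cong') (auto simp: e_def)
      also have "\<dots> = e i g"
        using pick[of "\<lambda>k. a g (w k)" i] a g i by (auto simp: e_def)
      finally show ?thesis by simp
    qed
    then show ?thesis
      unfolding b_def using param[of "e i"] e i by auto
  qed
  \<comment> \<open>The coordinate vector of a combination of the \<open>b i\<close> is the product
    of \<open>c\<close> with the matrix \<open>e\<close>. Independence and spanning thereby become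
    statements about coordinates.\<close>
  have combine: "(\<Oplus>\<^bsub>M\<^esub>i\<in>K. c i \<odot>\<^bsub>M\<^esub> b i) = (\<Oplus>\<^bsub>M\<^esub>g\<in>I. (\<Oplus>i\<in>K. c i \<otimes> e i g) \<odot>\<^bsub>M\<^esub> T g)"
    if c: "c \<in> K \<rightarrow> carrier R" for c
  proof -
    have cl: "c i \<in> carrier R" "c i \<otimes> e i g \<in> carrier R" if "i \<in> K" "g \<in> I" for i g
      using c e that by auto
    have Tc: "T g \<in> carrier M" if "g \<in> I" for g
      using T that by auto
    have "(\<Oplus>\<^bsub>M\<^esub>i\<in>K. c i \<odot>\<^bsub>M\<^esub> b i) = (\<Oplus>\<^bsub>M\<^esub>i\<in>K. \<Oplus>\<^bsub>M\<^esub>g\<in>I. (c i \<otimes> e i g) \<odot>\<^bsub>M\<^esub> T g)"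
    proof (intro M.finsum_cong')
      fix i assume i: "i \<in> K"
      then have "c i \<odot>\<^bsub>M\<^esub> b i = (\<Oplus>\<^bsub>M\<^esub>g\<in>I. c i \<odot>\<^bsub>M\<^esub> (e i g \<odot>\<^bsub>M\<^esub> T g))"
        unfolding b_def using c e Tc fin by (intro finsum_smult_ldistr) auto
      also have "\<dots> = (\<Oplus>\<^bsub>M\<^esub>g\<in>I. (c i \<otimes> e i g) \<odot>\<^bsub>M\<^esub> T g)"
        using i c e Tc by (intro M.finsum_cong') (auto simp: smult_assoc1 Pi_def)
      finally show "c i \<odot>\<^bsub>M\<^esub> b i = (\<Oplus>\<^bsub>M\<^esub>g\<in>I. (c i \<otimes> e i g) \<odot>\<^bsub>M\<^esub> T g)" .
    qed (use cl Tc in \<open>auto intro!: M.finsum_closed\<close>)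
    also have "\<dots> = (\<Oplus>\<^bsub>M\<^esub>g\<in>I. \<Oplus>\<^bsub>M\<^esub>i\<in>K. (c i \<otimes> e i g) \<odot>\<^bsub>M\<^esub> T g)"
      using cl Tc fin finK by (intro M.finsum_swap) auto
    also have "\<dots> = (\<Oplus>\<^bsub>M\<^esub>g\<in>I. (\<Oplus>i\<in>K. c i \<otimes> e i g) \<odot>\<^bsub>M\<^esub> T g)"
      using cl Tc finK
      by (intro M.finsum_cong') (auto simp: finsum_smult_rdistr intro!: R.finsum_closed)
    finally show ?thesis .
  qed
  have sum_closed: "(\<lambda>g. \<Oplus>i\<in>K. c i \<otimes> e i g) \<in> I \<rightarrow> carrier R" if "c \<in> K \<rightarrow> carrier R" for c
    using that e by (auto intro!: R.finsum_closed)
  have "module_basis R M N K b"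
    unfolding module_basis_def
  proof (intro conjI ballI impI)
    fix c i assume c: "c \<in> K \<rightarrow> carrier R" and "(\<Oplus>\<^bsub>M\<^esub>i\<in>K. c i \<odot>\<^bsub>M\<^esub> b i) = \<zero>\<^bsub>M\<^esub>" and i: "i \<in> K"
    \<comment> \<open>All \<open>T\<close>-coordinates of the combination vanish; the one at
      \<open>w i\<close> is \<open>c i\<close> by \<open>coord\<close>.\<close>
    then have "(\<Oplus>k\<in>K. c k \<otimes> e k (w i)) = \<zero>"
      using indep[OF sum_closed[OF c]] combine[OF c] w by auto
    then show "c i = \<zero>"
      using coord[OF c i] by simp
  next
    fix x assume x: "x \<in> N"
    then obtain c where c: "c \<in> I \<rightarrow> carrier R" and xc: "x = (\<Oplus>\<^bsub>M\<^esub>j\<in>I. c j \<odot>\<^bsub>M\<^esub> T j)"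
      using span submoduleE(1)[OF sub] by blast
    \<comment> \<open>The coefficients expressing \<open>x\<close> through the \<open>b i\<close>
      are its own coordinates at the \<open>w i\<close>.\<close>
    have cw: "(\<lambda>i. c (w i)) \<in> K \<rightarrow> carrier R"
      using c w by auto
    \<comment> \<open>At free coordinates this is \<open>coord\<close>; at the others it is the
      membership equation for \<open>x\<close>, with the factors commuted.\<close>
    have "c g = (\<Oplus>i\<in>K. c (w i) \<otimes> e i g)" if g: "g \<in> I" for g
    proof (cases "g \<in> w ` K")
      case True
      then show ?thesis using coord[OF cw] by auto
    next
      case False
      then have "c g = (\<Oplus>v\<in>w ` K. a g v \<otimes> c v)"
        using param[OF c] x xc g by auto
      also have "\<dots> = (\<Oplus>i\<in>K. a g (w i) \<otimes> c (w i))"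
        using a False g cw w by (intro R.finsum_reindex) auto
      also have "\<dots> = (\<Oplus>i\<in>K. c (w i) \<otimes> e i g)"
        using a False g cw by (intro R.finsum_cong') (auto simp: e_def Pi_def R.m_comm)
      finally show ?thesis .
    qed
    then have "x = (\<Oplus>\<^bsub>M\<^esub>g\<in>I. (\<Oplus>i\<in>K. c (w i) \<otimes> e i g) \<odot>\<^bsub>M\<^esub> T g)"
      unfolding xc using T sum_closed[OF cw] by (intro M.finsum_cong') (auto simp: Pi_def)
    then show "\<exists>c\<in>K \<rightarrow> carrier R. x = (\<Oplus>\<^bsub>M\<^esub>i\<in>K. c i \<odot>\<^bsub>M\<^esub> b i)"
      using combine[OF cw] cw by (intro bexI[of _ "\<lambda>i. c (w i)"]) auto
  qed (use sub finK bN in auto)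
  moreover have "basis_coeff R M I T (b j) (w i) = (if j = i then \<one> else \<zero>)"
    if "i \<in> K" "j \<in> K" for i j
  proof -
    have "basis_coeff R M I T (b j) (w i) = e j (w i)"
      unfolding b_def using basis e that w by (intro basis_coeff_eq) auto
    then show ?thesis
      using that w by (auto simp: e_def dest: inj_onD)
  qed
  ultimately show ?thesis
    using bN by (intro exI[of _ b]) auto
qed

end


section \<open>Associative algebras\<close>

text \<open>\<open>M\<close> may be noncommutative over the commutative ring \<open>R\<close>; the
  two laws say that scalars can be pulled out of either factor of a product.\<close>

locale assoc_algebra = module + M?: ring M +
  assumes smult_mult_left:
      "\<lbrakk>a \<in> carrier R; x \<in> carrier M; y \<in> carrier M\<rbrakk> \<Longrightarrow>
      (a \<odot>\<^bsub>M\<^esub> x) \<otimes>\<^bsub>M\<^esub> y = a \<odot>\<^bsub>M\<^esub> (x \<otimes>\<^bsub>M\<^esub> y)"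
    and smult_mult_right:
      "\<lbrakk>a \<in> carrier R; x \<in> carrier M; y \<in> carrier M\<rbrakk> \<Longrightarrow>
      x \<otimes>\<^bsub>M\<^esub> (a \<odot>\<^bsub>M\<^esub> y) = a \<odot>\<^bsub>M\<^esub> (x \<otimes>\<^bsub>M\<^esub> y)"
begin

text \<open>Closure under scalars takes both compatibility laws, since the scaled element stands on
  the left in one product and on the right in the other.\<close>

lemma centralizer_submodule:
  assumes B: "B \<subseteq> carrier M"
  shows "submodule (centralizer M B) R M"
proof (rule submoduleI)
  fix x assume x: "x \<in> centralizer M B"
  show "\<ominus>\<^bsub>M\<^esub> x \<in> centralizer M B"
    using x B by (auto simp: centralizer_def M.l_minus M.r_minus subset_iff)
next
  fix x y assume "x \<in> centralizer M B" "y \<in> centralizer M B"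
  then show "x \<oplus>\<^bsub>M\<^esub> y \<in> centralizer M B"
    using B by (auto simp: centralizer_def M.l_distr M.r_distr subset_iff)
next
  fix c x assume "c \<in> carrier R" "x \<in> centralizer M B"
  then show "c \<odot>\<^bsub>M\<^esub> x \<in> centralizer M B"
    using B by (auto simp: centralizer_def smult_mult_left smult_mult_right subset_iff)
qed (use B in \<open>auto simp: centralizer_def\<close>)

text \<open>The whole carrier is one of the sets being intersected.\<close>

lemma generated_subalgebra_subset:
  assumes "X \<subseteq> carrier M"
  shows "generated_subalgebra R M X \<subseteq> carrier M"
proof -
  have "subring (carrier M) M"
    by (rule M.carrier_is_subring)
  then show ?thesis
    using assms carrier_is_submodule unfolding generated_subalgebra_def by blast
qed

text \<open>A ring ideal of a unital algebra is automatically a submodule, because scaling by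
  \<open>a\<close> is multiplication by the ring element \<open>a\<close> times one.\<close>

lemma ideal_smult_closed:
  assumes "ideal I M" "a \<in> carrier R" "x \<in> I"
  shows "a \<odot>\<^bsub>M\<^esub> x \<in> I"
proof -
  interpret I: ideal I M by fact
  have "(a \<odot>\<^bsub>M\<^esub> \<one>\<^bsub>M\<^esub>) \<otimes>\<^bsub>M\<^esub> x \<in> I"
    using assms by (intro I.I_l_closed) auto
  then show ?thesis
    using assms by (simp add: smult_mult_left I.a_Hcarr)
qed

text \<open>Well-definedness of the scalar action: two representatives differ by an element of
  \<open>I\<close>, which stays in \<open>I\<close> when scaled, so the union defining the action
  runs over equal cosets.\<close>

lemma quotient_smult:
  assumes I: "ideal I M" and c: "c \<in> carrier R" and x: "x \<in> carrier M"
  shows "c \<odot>\<^bsub>quotient_algebra M I\<^esub> (I +>\<^bsub>M\<^esub> x) = I +>\<^bsub>M\<^esub> (c \<odot>\<^bsub>M\<^esub> x)"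
proof -
  interpret I: ideal I M by fact
  have "I +>\<^bsub>M\<^esub> (c \<odot>\<^bsub>M\<^esub> y) = I +>\<^bsub>M\<^esub> (c \<odot>\<^bsub>M\<^esub> x)" if y: "y \<in> I +>\<^bsub>M\<^esub> x" for y
  proof -
    obtain h where h: "h \<in> I" "y = h \<oplus>\<^bsub>M\<^esub> x"
      using y by (auto simp: a_r_coset_def r_coset_def)
    then have "c \<odot>\<^bsub>M\<^esub> y = c \<odot>\<^bsub>M\<^esub> h \<oplus>\<^bsub>M\<^esub> c \<odot>\<^bsub>M\<^esub> x"
      using c x by (simp add: smult_r_distr I.a_Hcarr)
    then have "c \<odot>\<^bsub>M\<^esub> y \<in> I +>\<^bsub>M\<^esub> (c \<odot>\<^bsub>M\<^esub> x)"
      using ideal_smult_closed[OF I c h(1)] by (auto simp: a_r_coset_def r_coset_def)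
    then show ?thesis
      using c x I.a_repr_independence' by (metis smult_closed)
  qed
  then have "(\<Union>y\<in>I +>\<^bsub>M\<^esub> x. I +>\<^bsub>M\<^esub> (c \<odot>\<^bsub>M\<^esub> y)) = (\<Union>y\<in>I +>\<^bsub>M\<^esub> x. I +>\<^bsub>M\<^esub> (c \<odot>\<^bsub>M\<^esub> x))"
    by (rule SUP_cong[OF HOL.refl])
  \<comment> \<open>The index set contains \<open>x\<close>; a union of a constant family over a
    nonempty set is that constant.\<close>
  also have "\<dots> = I +>\<^bsub>M\<^esub> (c \<odot>\<^bsub>M\<^esub> x)"
    using I.a_rcos_self[OF x] by blast
  finally show ?thesis
    by (simp add: quotient_algebra_def)
qed

text \<open>Every element is the coset of a representative and all operations act on
  representatives, so each law descends from \<open>M\<close>.\<close>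

lemma quotient_algebra_is_assoc_algebra:
  assumes I: "ideal I M"
  shows "assoc_algebra R (quotient_algebra M I)"
proof -
  interpret I: ideal I M by fact
  let ?Q = "quotient_algebra M I"
  have ops: "(I +>\<^bsub>M\<^esub> x) \<oplus>\<^bsub>?Q\<^esub> (I +>\<^bsub>M\<^esub> y) = I +>\<^bsub>M\<^esub> (x \<oplus>\<^bsub>M\<^esub> y)"
    "(I +>\<^bsub>M\<^esub> x) \<otimes>\<^bsub>?Q\<^esub> (I +>\<^bsub>M\<^esub> y) = I +>\<^bsub>M\<^esub> (x \<otimes>\<^bsub>M\<^esub> y)"
    if "x \<in> carrier M" "y \<in> carrier M" for x y
    using that by (simp_all add: quotient_algebra_def FactRing_def I.a_rcos_sum I.rcoset_mult_add)
  have carrier: "X \<in> carrier ?Q \<longleftrightarrow> (\<exists>x\<in>carrier M. X = I +>\<^bsub>M\<^esub> x)" for X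
    by (auto simp: quotient_algebra_def FactRing_def A_RCOSETS_def' a_r_coset_def r_coset_def)
  \<comment> \<open>The zero of the quotient is \<open>I\<close> itself and has to be recognized as
    the coset of zero before the rules for cosets apply.\<close>
  have units: "\<zero>\<^bsub>?Q\<^esub> = I +>\<^bsub>M\<^esub> \<zero>\<^bsub>M\<^esub>" "\<one>\<^bsub>?Q\<^esub> = I +>\<^bsub>M\<^esub> \<one>\<^bsub>M\<^esub>"
    using M.a_coset_add_zero[OF I.a_subset] by (simp_all add: quotient_algebra_def FactRing_def)
  note rules = ops units quotient_smult[OF I]
  have abelian: "abelian_group ?Q"
  proof (rule abelian_groupI)
    fix X assume "X \<in> carrier ?Q"
    then obtain x where x: "x \<in> carrier M" "X = I +>\<^bsub>M\<^esub> x"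
      by (auto simp: carrier)
    then have "(I +>\<^bsub>M\<^esub> (\<ominus>\<^bsub>M\<^esub> x)) \<oplus>\<^bsub>?Q\<^esub> X = \<zero>\<^bsub>?Q\<^esub>"
      by (simp add: rules M.l_neg)
    then show "\<exists>Y\<in>carrier ?Q. Y \<oplus>\<^bsub>?Q\<^esub> X = \<zero>\<^bsub>?Q\<^esub>"
      using x by (intro bexI) (auto simp: carrier)
  qed (auto simp: carrier rules M.a_assoc M.a_comm M.a_lcomm)
  have Q: "ring ?Q"
    by (intro ringI monoidI abelian)
      (auto simp: carrier rules M.m_assoc M.l_distr M.r_distr)
  show ?thesis
  proof (intro assoc_algebra.intro assoc_algebra_axioms.intro moduleI)
    show "cring R" by unfold_locales
    show "abelian_group ?Q" by (rule abelian)
    show "ring ?Q" by (rule Q)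
  qed (auto simp: carrier rules smult_l_distr smult_r_distr smult_assoc1 smult_mult_left
        smult_mult_right intro: bexI)
qed

end


section \<open>Free algebras\<close>

text \<open>Laws are checked at each word \<open>u\<close>, where they reduce to identities of
  finite sums in \<open>R\<close>. Closure additionally needs finite support.\<close>

lemma (in cring) free_algebra_is_assoc_algebra: "assoc_algebra R (free_algebra R X)"
proof -
  let ?F = "free_algebra R X"
  have coeff: "f u \<in> carrier R" if "f \<in> carrier ?F" for f u
    using that by (auto simp: free_algebra_def)
  \<comment> \<open>Any finite set \<open>B\<close> containing the support suffices, so exact
    supports, which cancellation may shrink, need not be computed.\<close>
  have carrierI: "f \<in> carrier ?F"
    if "\<And>u. f u \<in> carrier R" "finite B" "\<And>u. f u \<noteq> \<zero> \<Longrightarrow> u \<in> B \<and> set u \<subseteq> X" for f B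
    using that finite_subset[of "{u. f u \<noteq> \<zero>}" B] by (auto simp: free_algebra_def)
  have supp: "finite {u. f u \<noteq> \<zero>}" "f u \<noteq> \<zero> \<Longrightarrow> set u \<subseteq> X" if "f \<in> carrier ?F" for f u
    using that by (auto simp: free_algebra_def)
  note defs = free_algebra_def[of R X]
  have add_closed: "f \<oplus>\<^bsub>?F\<^esub> g \<in> carrier ?F" if f: "f \<in> carrier ?F" and g: "g \<in> carrier ?F" for f g
  proof (rule carrierI[of _ "{u. f u \<noteq> \<zero>} \<union> {u. g u \<noteq> \<zero>}"])
    show "finite ({u. f u \<noteq> \<zero>} \<union> {u. g u \<noteq> \<zero>})"
      using supp(1) f g by blast
    show "(f \<oplus>\<^bsub>?F\<^esub> g) u \<in> carrier R" for u
      using coeff f g by (simp add: free_algebra_def)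
    fix u assume "(f \<oplus>\<^bsub>?F\<^esub> g) u \<noteq> \<zero>"
    then have "f u \<noteq> \<zero> \<or> g u \<noteq> \<zero>"
      by (auto simp: free_algebra_def)
    then show "u \<in> {u. f u \<noteq> \<zero>} \<union> {u. g u \<noteq> \<zero>} \<and> set u \<subseteq> X"
      using supp(2) f g by auto
  qed
  have smult_closed: "c \<odot>\<^bsub>?F\<^esub> f \<in> carrier ?F" if c: "c \<in> carrier R" and f: "f \<in> carrier ?F" for c f
  proof (rule carrierI[of _ "{u. f u \<noteq> \<zero>}"])
    show "(c \<odot>\<^bsub>?F\<^esub> f) u \<in> carrier R" for u
      using coeff f c by (simp add: free_algebra_def)
    fix u assume "(c \<odot>\<^bsub>?F\<^esub> f) u \<noteq> \<zero>"
    then have "f u \<noteq> \<zero>"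
      using c by (auto simp: free_algebra_def)
    then show "u \<in> {u. f u \<noteq> \<zero>} \<and> set u \<subseteq> X"
      using supp(2) f by auto
  qed (use supp f in auto)
  have mult_closed: "f \<otimes>\<^bsub>?F\<^esub> g \<in> carrier ?F" if f: "f \<in> carrier ?F" and g: "g \<in> carrier ?F" for f g
  \<comment> \<open>The support of a product lies among the concatenations of a support word of
    \<open>f\<close> with one of \<open>g\<close>.\<close>
  proof (rule carrierI[of _ "(\<lambda>(u, v). u @ v) ` ({u. f u \<noteq> \<zero>} \<times> {u. g u \<noteq> \<zero>})"])
    show "finite ((\<lambda>(u, v). u @ v) ` ({u. f u \<noteq> \<zero>} \<times> {u. g u \<noteq> \<zero>}))"
      using supp(1) f g by blast
    show "(f \<otimes>\<^bsub>?F\<^esub> g) u \<in> carrier R" for u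
      using coeff f g by (auto simp: free_algebra_def intro!: finsum_closed)
    fix u assume "(f \<otimes>\<^bsub>?F\<^esub> g) u \<noteq> \<zero>"
    \<comment> \<open>A nonzero sum has a nonzero term.\<close>
    then obtain k where "f (take k u) \<otimes> g (drop k u) \<noteq> \<zero>"
      by (auto simp: free_algebra_def intro: add.finprod_one_eqI)
    then have "f (take k u) \<noteq> \<zero>" "g (drop k u) \<noteq> \<zero>"
      using coeff f g by auto
    moreover have "set u = set (take k u) \<union> set (drop k u)"
      by (metis append_take_drop_id set_append)
    moreover have "u = (\<lambda>(u, v). u @ v) (take k u, drop k u)"
      by simp
    ultimately show "u \<in> (\<lambda>(u, v). u @ v) ` ({u. f u \<noteq> \<zero>} \<times> {u. g u \<noteq> \<zero>}) \<and> set u \<subseteq> X"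
      using supp(2) f g by blast
  qed
  have zero_closed: "\<zero>\<^bsub>?F\<^esub> \<in> carrier ?F"
    by (simp add: free_algebra_def)
  have one_closed: "\<one>\<^bsub>?F\<^esub> \<in> carrier ?F"
    by (rule carrierI[of _ "{[]}"]) (auto simp: free_algebra_def split: if_splits)
  have neg_closed: "(\<lambda>u. \<ominus> f u) \<in> carrier ?F" if f: "f \<in> carrier ?F" for f
    using f coeff by (intro carrierI[of _ "{u. f u \<noteq> \<zero>}"]) (auto dest: supp)
  have abelian: "abelian_group ?F"
  proof (rule abelian_groupI)
    fix f assume f: "f \<in> carrier ?F"
    show "\<exists>g\<in>carrier ?F. g \<oplus>\<^bsub>?F\<^esub> f = \<zero>\<^bsub>?F\<^esub>"
      using coeff[OF f] by (intro bexI[OF _ neg_closed[OF f]]) (simp add: free_algebra_def l_neg)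
  next
    fix f g h assume "f \<in> carrier ?F" "g \<in> carrier ?F" "h \<in> carrier ?F"
    note [simp] = this[THEN coeff]
    show "f \<oplus>\<^bsub>?F\<^esub> g \<oplus>\<^bsub>?F\<^esub> h = f \<oplus>\<^bsub>?F\<^esub> (g \<oplus>\<^bsub>?F\<^esub> h)"
      by (simp add: defs a_assoc)
    show "f \<oplus>\<^bsub>?F\<^esub> g = g \<oplus>\<^bsub>?F\<^esub> f"
      by (simp add: defs a_comm)
    show "\<zero>\<^bsub>?F\<^esub> \<oplus>\<^bsub>?F\<^esub> f = f"
      by (simp add: defs)
  qed (use add_closed zero_closed in auto)
  have assoc: "(f \<otimes>\<^bsub>?F\<^esub> g) \<otimes>\<^bsub>?F\<^esub> h = f \<otimes>\<^bsub>?F\<^esub> (g \<otimes>\<^bsub>?F\<^esub> h)"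
    if f: "f \<in> carrier ?F" and g: "g \<in> carrier ?F" and h: "h \<in> carrier ?F" for f g h
  proof
    fix u :: "'c list"
    let ?n = "length u"
    note cl [simp] = coeff[OF f] coeff[OF g] coeff[OF h]
    \<comment> \<open>The contribution of cutting \<open>u\<close> at positions \<open>j\<close> and
      \<open>k\<close> into three factors.\<close>
    define t where "t j k = f (take j u) \<otimes> (g (drop j (take k u)) \<otimes> h (drop k u))" for j k
    have "((f \<otimes>\<^bsub>?F\<^esub> g) \<otimes>\<^bsub>?F\<^esub> h) u =
        (\<Oplus>k\<in>{..?n}. (\<Oplus>j\<in>{..length (take k u)}. f (take j (take k u)) \<otimes> g (drop j (take k u))) \<otimes> h (drop k u))"
      by (simp add: free_algebra_def)
    also have "\<dots> = (\<Oplus>k\<in>{..?n}. \<Oplus>j\<in>{..k}. t j k)"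
    proof (intro finsum_cong')
      fix k assume "k \<in> {..?n}"
      then have k: "length (take k u) = k" by auto
      show "(\<Oplus>j\<in>{..length (take k u)}. f (take j (take k u)) \<otimes> g (drop j (take k u))) \<otimes> h (drop k u)
          = (\<Oplus>j\<in>{..k}. t j k)"
        unfolding k by (subst finsum_ldistr)
          (auto intro!: finsum_cong' simp: t_def m_assoc min_def)
    qed (auto simp: t_def intro!: finsum_closed)
    also have "\<dots> = (\<Oplus>j\<in>{..?n}. \<Oplus>i\<in>{..?n - j}. t j (i + j))"
      by (rule finsum_triangle) (simp add: t_def)
    \<comment> \<open>The middle factor is now the prefix of length \<open>i\<close> of
      \<open>drop j u\<close>, matching the inner product of \<open>g\<close> and
      \<open>h\<close>.\<close>
    also have "\<dots> = (\<Oplus>j\<in>{..?n}. f (take j u) \<otimes>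
        (\<Oplus>i\<in>{..length (drop j u)}. g (take i (drop j u)) \<otimes> h (drop i (drop j u))))"
      by (intro finsum_cong')
        (auto simp: finsum_rdistr t_def take_drop intro!: finsum_closed finsum_cong')
    also have "\<dots> = (f \<otimes>\<^bsub>?F\<^esub> (g \<otimes>\<^bsub>?F\<^esub> h)) u"
      by (simp add: free_algebra_def)
    finally show "((f \<otimes>\<^bsub>?F\<^esub> g) \<otimes>\<^bsub>?F\<^esub> h) u = (f \<otimes>\<^bsub>?F\<^esub> (g \<otimes>\<^bsub>?F\<^esub> h)) u" .
  qed
  have l_one: "\<one>\<^bsub>?F\<^esub> \<otimes>\<^bsub>?F\<^esub> f = f" if f: "f \<in> carrier ?F" for f
  proof
    fix u :: "'c list"
    \<comment> \<open>Only the cut at 0 leaves an empty prefix, the sole word on which the unit is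
      supported.\<close>
    have "(\<one>\<^bsub>?F\<^esub> \<otimes>\<^bsub>?F\<^esub> f) u = (\<Oplus>k\<in>{..length u}. if 0 = k then f (drop k u) else \<zero>)"
      using coeff[OF f]
      by (auto simp: free_algebra_def intro!: finsum_cong')
    also have "\<dots> = f (drop 0 u)"
      using coeff[OF f] by (intro finsum_singleton) auto
    finally show "(\<one>\<^bsub>?F\<^esub> \<otimes>\<^bsub>?F\<^esub> f) u = f u" by simp
  qed
  have r_one: "f \<otimes>\<^bsub>?F\<^esub> \<one>\<^bsub>?F\<^esub> = f" if f: "f \<in> carrier ?F" for f
  proof
    fix u :: "'c list"
    have "(f \<otimes>\<^bsub>?F\<^esub> \<one>\<^bsub>?F\<^esub>) u = (\<Oplus>k\<in>{..length u}. if length u = k then f (take k u) else \<zero>)"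
      using coeff[OF f]
      by (auto simp: free_algebra_def intro!: finsum_cong')
    also have "\<dots> = f (take (length u) u)"
      using coeff[OF f] by (intro finsum_singleton) auto
    finally show "(f \<otimes>\<^bsub>?F\<^esub> \<one>\<^bsub>?F\<^esub>) u = f u" by simp
  qed
  have distr_left: "(f \<oplus>\<^bsub>?F\<^esub> g) \<otimes>\<^bsub>?F\<^esub> h = f \<otimes>\<^bsub>?F\<^esub> h \<oplus>\<^bsub>?F\<^esub> g \<otimes>\<^bsub>?F\<^esub> h"
    if "f \<in> carrier ?F" "g \<in> carrier ?F" "h \<in> carrier ?F" for f g h
    using that[THEN coeff]
    by (simp add: defs fun_eq_iff l_distr)
  have distr_right: "h \<otimes>\<^bsub>?F\<^esub> (f \<oplus>\<^bsub>?F\<^esub> g) = h \<otimes>\<^bsub>?F\<^esub> f \<oplus>\<^bsub>?F\<^esub> h \<otimes>\<^bsub>?F\<^esub> g"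
    if "f \<in> carrier ?F" "g \<in> carrier ?F" "h \<in> carrier ?F" for f g h
    using that[THEN coeff]
    by (simp add: defs fun_eq_iff r_distr)
  have ring: "ring ?F"
    by (intro ringI monoidI abelian mult_closed one_closed assoc l_one r_one distr_left distr_right)
  show ?thesis
  proof (intro assoc_algebra.intro assoc_algebra_axioms.intro moduleI is_cring abelian ring smult_closed)
    fix c f g assume c: "c \<in> carrier R" and fg: "f \<in> carrier ?F" "g \<in> carrier ?F"
    note [simp] = fg[THEN coeff] c
    show "(c \<odot>\<^bsub>?F\<^esub> f) \<otimes>\<^bsub>?F\<^esub> g = c \<odot>\<^bsub>?F\<^esub> (f \<otimes>\<^bsub>?F\<^esub> g)"
      by (simp add: defs fun_eq_iff finsum_rdistr Pi_def m_assoc)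
    show "f \<otimes>\<^bsub>?F\<^esub> (c \<odot>\<^bsub>?F\<^esub> g) = c \<odot>\<^bsub>?F\<^esub> (f \<otimes>\<^bsub>?F\<^esub> g)"
      by (simp add: defs fun_eq_iff finsum_rdistr Pi_def m_lcomm)
    show "c \<odot>\<^bsub>?F\<^esub> (f \<oplus>\<^bsub>?F\<^esub> g) = c \<odot>\<^bsub>?F\<^esub> f \<oplus>\<^bsub>?F\<^esub> c \<odot>\<^bsub>?F\<^esub> g"
      by (simp add: defs fun_eq_iff r_distr)
    fix d assume d: "d \<in> carrier R"
    show "(c \<oplus> d) \<odot>\<^bsub>?F\<^esub> f = c \<odot>\<^bsub>?F\<^esub> f \<oplus>\<^bsub>?F\<^esub> d \<odot>\<^bsub>?F\<^esub> f"
      using d by (simp add: defs fun_eq_iff l_distr)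
    show "c \<otimes> d \<odot>\<^bsub>?F\<^esub> f = c \<odot>\<^bsub>?F\<^esub> (d \<odot>\<^bsub>?F\<^esub> f)"
      using d by (simp add: defs fun_eq_iff m_assoc)
  next
    fix f assume "f \<in> carrier ?F"
    then show "\<one> \<odot>\<^bsub>?F\<^esub> f = f"
      by (simp add: defs fun_eq_iff)
  qed
qed

lemma (in cring) free_gen_closed: "x \<in> X \<Longrightarrow> free_gen R x \<in> carrier (free_algebra R X)"
  by (auto simp: free_gen_def free_algebra_def)


section \<open>The Hecke algebra\<close>

text \<open>The laws are inherited from the type of polynomials; what remains is that negatives,
  sums and products introduce no variable outside \<open>V\<close>. For products, each monomial is a
  sum of exponents of the factors.\<close>

lemma int_poly_ring_is_cring: "cring (int_poly_ring V)"
proof (rule cringI)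
  show "abelian_group (int_poly_ring V)"
  proof (rule abelian_groupI)
    fix p assume "p \<in> carrier (int_poly_ring V)"
    then show "\<exists>q\<in>carrier (int_poly_ring V). q \<oplus>\<^bsub>int_poly_ring V\<^esub> p = \<zero>\<^bsub>int_poly_ring V\<^esub>"
      by (intro bexI[of _ "- p"]) (auto simp: int_poly_ring_def)
  next
    fix p q assume "p \<in> carrier (int_poly_ring V)" "q \<in> carrier (int_poly_ring V)"
    then show "p \<oplus>\<^bsub>int_poly_ring V\<^esub> q \<in> carrier (int_poly_ring V)"
      using Poly_Mapping.keys_add[of p q] by (auto simp: int_poly_ring_def)
  qed (auto simp: int_poly_ring_def)
  show "Group.comm_monoid (int_poly_ring V)"
  proof (rule comm_monoidI)
    fix p q assume pq: "p \<in> carrier (int_poly_ring V)" "q \<in> carrier (int_poly_ring V)"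
    have "Poly_Mapping.keys m \<subseteq> V" if m: "m \<in> Poly_Mapping.keys (p * q)" for m
    proof -
      obtain k l where "m = k + l" "k \<in> Poly_Mapping.keys p" "l \<in> Poly_Mapping.keys q"
        using m keys_mult[of p q] by blast
      then show ?thesis
        using pq Poly_Mapping.keys_add[of k l] by (fastforce simp: int_poly_ring_def)
    qed
    then show "p \<otimes>\<^bsub>int_poly_ring V\<^esub> q \<in> carrier (int_poly_ring V)"
      by (auto simp: int_poly_ring_def)
  qed (auto simp: int_poly_ring_def algebra_simps)
qed (auto simp: int_poly_ring_def algebra_simps)

text \<open>For \<open>i = 0\<close> the parameter is the constant 1; otherwise the bound by the
  order of \<open>s\<close> puts its label into \<open>hecke_vars\<close>.\<close>

lemma hecke_param_closed:
  assumes "s \<in> S" "i < group.ord W s"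
  shows "hecke_param W s i \<in> carrier (hecke_ring W S)"
  using assms by (auto simp: hecke_param_def int_poly_var_def hecke_ring_def int_poly_ring_def
      hecke_vars_def Suc_le_eq)

lemma (in Group.monoid) word_prod_closed: "set u \<subseteq> carrier G \<Longrightarrow> word_prod G u \<in> carrier G"
  by (induction u) (auto simp: word_prod_def)

text \<open>\<open>genideal_ideal\<close> requires the relators to lie in the free algebra, which
  holds because the homogeneous relations are between words over \<open>S\<close>.\<close>

lemma hecke_ideal_is_ideal:
  assumes "coxeter_type_presentation W S E"
  shows "ideal (hecke_ideal W S E) (free_algebra (hecke_ring W S) S)"
proof -
  let ?R = "hecke_ring W S"
  interpret R: cring ?R
    unfolding hecke_ring_def by (rule int_poly_ring_is_cring)
  interpret F: assoc_algebra ?R "free_algebra ?R S"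
    by (rule R.free_algebra_is_assoc_algebra)
  have E: "set u \<subseteq> S" "set v \<subseteq> S" if "(u, v) \<in> E" for u v
    using assms that by (auto simp: coxeter_type_presentation_def)
  have word: "word_prod (free_algebra ?R S) (map (free_gen ?R) u) \<in> carrier (free_algebra ?R S)"
    if "set u \<subseteq> S" for u
    using that by (intro F.M.word_prod_closed) (auto intro!: R.free_gen_closed)
  have "hecke_relators W S E \<subseteq> carrier (free_algebra ?R S)"
    unfolding hecke_relators_def Let_def
    by (auto intro!: F.M.minus_closed F.M.nat_pow_closed F.M.finsum_closed F.smult_closed
        word R.free_gen_closed hecke_param_closed dest: E)
  then show ?thesis
    unfolding hecke_ideal_def by (rule F.M.genideal_ideal)
qed

lemma hecke_algebra_is_assoc_algebra:
  assumes "coxeter_type_presentation W S E"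
  shows "assoc_algebra (hecke_ring W S) (hecke_algebra W S E)"
  unfolding hecke_algebra_def
  by (intro assoc_algebra.quotient_algebra_is_assoc_algebra cring.free_algebra_is_assoc_algebra
      hecke_ideal_is_ideal assms) (simp add: hecke_ring_def int_poly_ring_is_cring)

lemma hecke_parabolic_subset:
  assumes pres: "coxeter_type_presentation W S E" and "J \<subseteq> S"
  shows "hecke_parabolic W S E J \<subseteq> carrier (hecke_algebra W S E)"
proof -
  let ?R = "hecke_ring W S"
  interpret R: cring ?R
    unfolding hecke_ring_def by (rule int_poly_ring_is_cring)
  interpret H: assoc_algebra ?R "hecke_algebra W S E"
    using pres by (rule hecke_algebra_is_assoc_algebra)
  interpret I: ideal "hecke_ideal W S E" "free_algebra ?R S"
    using pres by (rule hecke_ideal_is_ideal)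
  have "hecke_T W S E s \<in> carrier (hecke_algebra W S E)" if "s \<in> S" for s
    using I.a_rcosetsI[OF I.a_subset R.free_gen_closed[OF that]]
    by (simp add: hecke_T_def hecke_algebra_def quotient_algebra_def FactRing_def)
  then show ?thesis
    unfolding hecke_parabolic_def using \<open>J \<subseteq> S\<close> by (intro H.generated_subalgebra_subset) auto
qed


section \<open>The group and its conjugacy classes\<close>

lemma group_GL: "group (GL :: (complex^'n^'n) monoid)"
proof (rule groupI)
  fix A :: "complex^'n^'n" assume "A \<in> carrier GL"
  then obtain B where "A ** B = mat 1" "B ** A = mat 1"
    by (auto simp: GL_def invertible_def)
  then show "\<exists>B\<in>carrier GL. B \<otimes>\<^bsub>GL\<^esub> A = \<one>\<^bsub>GL\<^esub>"
    by (intro bexI[of _ B]) (auto simp: GL_def invertible_def)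
next
  show "\<one>\<^bsub>GL\<^esub> \<in> carrier (GL :: (complex^'n^'n) monoid)"
    by (auto simp: GL_def invertible_def)
qed (auto simp: GL_def invertible_mult matrix_mul_assoc)

lemma complex_reflection_group_is_group:
  assumes "complex_reflection_group W"
  shows "group W"
  using assms subgroup.subgroup_is_group[OF _ group_GL]
  unfolding complex_reflection_group_def by metis

text \<open>The classes are the orbits of the conjugation action restricted to the subgroup
  generated by \<open>J\<close>, and orbits of a group action partition the set acted on.\<close>

lemma (in group) J_conjugacy_classes_partition:
  "partition (carrier G) (J_conjugacy_classes G J)"
proof -
  interpret conj: group_action G "carrier G" "conj_action G"
    using action_by_conjugation by (simp add: conj_action_def [abs_def])
  have "carrier (subgroup_generated G J) \<subseteq> carrier G"
    by (rule carrier_subgroup_generated_subset)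
  \<comment> \<open>The subgroup shares its multiplication with \<open>G\<close>, so the
    homomorphism into the permutations of the carrier restricts to it.\<close>
  then have "conj_action G \<in> hom (subgroup_generated G J) (BijGroup (carrier G))"
    using conj.group_hom group_hom.homh by (fastforce simp: hom_def)
  then interpret J: group_action "subgroup_generated G J" "carrier G" "conj_action G"
    by (intro group_action.intro group_hom.intro group_hom_axioms.intro
        group_subgroup_generated group_BijGroup)
  show ?thesis
    unfolding J_conjugacy_classes_def by (rule J.orbit_partition)
qed

theorem proposition2p6:
  fixes W :: "(complex^'n^'n) monoid"
    and S J :: "(complex^'n^'n) set"
    and E :: "((complex^'n^'n) list \<times> (complex^'n^'n) list) set"
    and C :: "nat \<Rightarrow> (complex^'n^'n) set"
    and r :: nat
    and \<rho> :: "complex^'n^'n \<Rightarrow> (complex^'n^'n) list"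
    and w :: "nat \<Rightarrow> complex^'n^'n"
    and a :: "complex^'n^'n \<Rightarrow> complex^'n^'n \<Rightarrow> (((complex^'n^'n) set \<times> nat) \<Rightarrow>\<^sub>0 nat) \<Rightarrow>\<^sub>0 int"
  defines "R \<equiv> hecke_ring W S"
    and "H \<equiv> hecke_algebra W S E"
    and "TB \<equiv> (\<lambda>g. hecke_T_word W S E (\<rho> g))"
    and "Z \<equiv> centralizer (hecke_algebra W S E) (hecke_parabolic W S E J)"
    and "M \<equiv> w ` {1..r}"
  assumes "complex_reflection_group W"
    and "coxeter_type_presentation W S E"
    and "J \<subseteq> S"
    and "bij_betw C {1..r} (J_conjugacy_classes W J)"
    and "reduced_basis W S E \<rho>"
    and "\<forall>i\<in>{1..r}. w i \<in> C i"
    and "\<forall>g\<in>carrier W - M. \<forall>v\<in>M. a g v \<in> carrier R"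
    and "\<forall>c \<in> carrier W \<rightarrow> carrier R.
           (\<Oplus>\<^bsub>H\<^esub>g\<in>carrier W. c g \<odot>\<^bsub>H\<^esub> TB g) \<in> Z \<longleftrightarrow>
           (\<forall>g \<in> carrier W - M. c g = (\<Oplus>\<^bsub>R\<^esub>v\<in>M. a g v \<otimes>\<^bsub>R\<^esub> c v))"
  shows "\<exists>b. b ` {1..r} \<subseteq> Z \<and>
           (\<forall>i\<in>{1..r}. basis_coeff R H (carrier W) TB (b i) (w i) = \<one>\<^bsub>R\<^esub> \<and>
              (\<forall>j\<in>{1..r}. j \<noteq> i \<longrightarrow> basis_coeff R H (carrier W) TB (b j) (w i) = \<zero>\<^bsub>R\<^esub>)) \<and>
           module_basis R H Z {1..r} b"
proof -
  have crg: "complex_reflection_group W" and pres: "coxeter_type_presentation W S E"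
    and C: "bij_betw C {1..r} (J_conjugacy_classes W J)" and red: "reduced_basis W S E \<rho>"
    and wC: "\<And>i. i \<in> {1..r} \<Longrightarrow> w i \<in> C i"
    using assms by auto
  interpret W: group W
    using crg by (rule complex_reflection_group_is_group)
  interpret H: assoc_algebra R H
    unfolding R_def H_def using pres by (rule hecke_algebra_is_assoc_algebra)
  have part: "partition (carrier W) (J_conjugacy_classes W J)"
    by (rule W.J_conjugacy_classes_partition)
  have Ci: "C i \<in> J_conjugacy_classes W J" if "i \<in> {1..r}" for i
    using C that by (auto simp: bij_betw_def)
  have w_carrier: "w ` {1..r} \<subseteq> carrier W"
    using wC Ci part by (fastforce simp: partition_def)
  have "inj_on w {1..r}"
  proof (rule inj_onI)
    fix i j assume ij: "i \<in> {1..r}" "j \<in> {1..r}" "w i = w j"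
    \<comment> \<open>In a partition, the common element \<open>w i = w j\<close> lies in only one
      class.\<close>
    then have "C i = C j"
      using wC[of i] wC[of j] Ci[of i] Ci[of j] part w_carrier
      unfolding partition_def by (metis image_subset_iff)
    then show "i = j"
      using C ij by (auto simp: bij_betw_def dest: inj_onD)
  qed
  moreover have "module_basis R H (carrier H) (carrier W) TB"
    using red by (simp add: reduced_basis_def R_def H_def TB_def)
  moreover have "submodule Z R H"
    unfolding Z_def R_def H_def
    by (rule assoc_algebra.centralizer_submodule
        [OF hecke_algebra_is_assoc_algebra[OF pres] hecke_parabolic_subset[OF pres \<open>J \<subseteq> S\<close>]])
  \<comment> \<open>The five definitions come first in \<open>assms\<close>; numbers 12 and 13 are
    the closure of \<open>a\<close> and the equations describing \<open>Z\<close>.\<close>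
  ultimately show ?thesis
    using w_carrier assms(12,13) unfolding M_def
    by (intro H.basis_of_parametrized_submodule) auto
qed

end
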